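(* Let $J(x)=\tfrac12(x+x^{-1})-1$ for $x>0$. Let $S$ be a set with scale map $\iota_S:S\to\mathbb{R}_{>0}$, and let $O=\{o_1,\dots,o_N\}$ be a finite set with scale map $\iota_O:O\to\mathbb{R}_{>0}$ such that the values $y_i:=\iota_O(o_i)$ are pairwise distinct and ordered $0<y_1<\cdots<y_N$. Let $c_{\mathcal{R}}(s,o)=J(\iota_S(s)/\iota_O(o))$. Define $m_i:=\sqrt{y_iy_{i+1}}$ for $i=1,\dots,N-1$, and set $m_0:=0$, $m_N:=+\infty$. Let $s\in S$ and $x:=\iota_S(s)$. Then: (i) if $m_{k-1}<x<m_k$ for some $k\in\{1,\dots,N\}$, then $o_k$ is the unique meaning of $s$, i.e. $\mathrm{Mean}_{\mathcal{R}}(s)=\{o_k\}$; (ii) if $x=m_k$ for some $k\in\{1,\dots,N-1\}$, then $s$ has exactly two meanings, namely $\mathrm{Mean}_{\mathcal{R}}(s)=\{o_k,o_{k+1}\}$. Equivalently, the map $x\mapsto\operatorname{arg\,min}_{i}J(x/y_i)$ is piecewise constant on the open intervals $(m_{k-1},m_k)$.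
   Context: For a reference cost $c_{\mathcal{R}}:S\times O\to\mathbb{R}_{\ge0}$ and $s\in S$, the meaning set is $\mathrm{Mean}_{\mathcal{R}}(s):=\{o\in O:\ c_{\mathcal{R}}(s,o)\le c_{\mathcal{R}}(s,o')\ \text{for all } o'\in O\}$; its elements are called the meanings of $s$. *)

theory Defs
  imports "HOL-Analysis.Analysis"
begin

(* Only the values at x > 0 are meaningful; inverse 0 = 0 makes the function total. *)
definition J :: "real \<Rightarrow> real" where
  "J x = (1/2) * (x + inverse x) - 1"

definition ref_cost :: "('s \<Rightarrow> real) \<Rightarrow> ('o \<Rightarrow> real) \<Rightarrow> 's \<Rightarrow> 'o \<Rightarrow> real" where
  "ref_cost \<iota>S \<iota>O s p = J (\<iota>S s / \<iota>O p)"

definition Mean :: "('s \<Rightarrow> 'o \<Rightarrow> real) \<Rightarrow> 'o set \<Rightarrow> 's \<Rightarrow> 'o set" where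
  "Mean c Obj s = {p \<in> Obj. \<forall>p'\<in>Obj. c s p \<le> c s p'}"

(* m_0 = 0, m_N = +infinity, and m_i is the geometric mean of y_i and y_(i+1) for 0 < i < N.
   The values at i > N are never used. *)
definition boundary :: "nat \<Rightarrow> (nat \<Rightarrow> real) \<Rightarrow> nat \<Rightarrow> ereal" where
  "boundary N y i =
     (if i = 0 then 0 else if i = N then \<infinity> else ereal (sqrt (y i * y (Suc i))))"

(* The set-valued arg min over the indices 1, ..., N. *)
definition argmin_index :: "nat \<Rightarrow> (nat \<Rightarrow> real) \<Rightarrow> real \<Rightarrow> nat set" where
  "argmin_index N y x = {i. is_arg_min (\<lambda>i. J (x / y i)) (\<lambda>i. i \<in> {1..N}) i}"

(* Reference costs take values in the nonnegative reals. *)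
lemma ref_cost_nonneg:
  assumes "\<iota>S s > 0" "\<iota>O p > 0"
  shows "ref_cost \<iota>S \<iota>O s p \<ge> 0"
proof -
  define x where "x = \<iota>S s / \<iota>O p"
  have "x > 0" using assms by (simp add: x_def)
  then have "J x = (x - 1)\<^sup>2 / (2 * x)"
    by (simp add: J_def field_simps power2_eq_square)
  then have "J x \<ge> 0" using \<open>x > 0\<close> by simp
  then show ?thesis by (simp add: ref_cost_def x_def)
qed

end

(* For 0 < a < b the difference J (x / a) - J (x / b) has the sign of x^2 - a b, so a scale x
   prefers the smaller reference exactly when it lies below the geometric mean of the two.
   By monotonicity of y, comparing x with the geometric means of neighbouring references decides
   the comparison with all other references. *)
theory Submission
  imports Defs
begin

lemma J_divide_diff:
  assumes "x > 0" "a > 0" "b > 0"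
  shows "J (x / a) - J (x / b) = (b - a) * (x\<^sup>2 - a * b) / (2 * x * a * b)"
  using assms by (simp add: J_def field_simps power2_eq_square)

lemma J_divide_less_iff:
  assumes "x > 0" "0 < a" "a < b"
  shows "J (x / a) < J (x / b) \<longleftrightarrow> x\<^sup>2 < a * b"
    and "J (x / b) < J (x / a) \<longleftrightarrow> a * b < x\<^sup>2"
proof -
  \<comment> \<open>The positive factor of the difference in \<open>J_divide_diff\<close>, split off
    so that only the sign of \<open>x\<^sup>2 - a * b\<close> remains to be read off.\<close>
  define c where "c = (b - a) / (2 * x * a * b)"
  have "c > 0" using assms by (simp add: c_def)
  have diff: "J (x / a) - J (x / b) = c * (x\<^sup>2 - a * b)"
    using J_divide_diff[of x a b] assms by (simp add: c_def)
  have "J (x / a) < J (x / b) \<longleftrightarrow> c * (x\<^sup>2 - a * b) < 0"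
    using diff by linarith
  then show "J (x / a) < J (x / b) \<longleftrightarrow> x\<^sup>2 < a * b"
    using \<open>c > 0\<close> by (simp add: mult_less_0_iff)
  have "J (x / b) < J (x / a) \<longleftrightarrow> 0 < c * (x\<^sup>2 - a * b)"
    using diff by linarith
  then show "J (x / b) < J (x / a) \<longleftrightarrow> a * b < x\<^sup>2"
    using \<open>c > 0\<close> by (simp add: zero_less_mult_iff)
qed

text \<open>Criterion for both cases of the theorem: \<open>A\<close> is a singleton inside an
  interval and a pair at a boundary, with \<open>v\<close> the common minimal cost.\<close>

lemma argmin_index_eqI:
  assumes "A \<subseteq> {1..N}" "A \<noteq> {}"
    and "\<And>i. i \<in> A \<Longrightarrow> J (x / y i) = v"
    and "\<And>i. i \<in> {1..N} - A \<Longrightarrow> v < J (x / y i)"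
  shows "argmin_index N y x = A"
proof (rule set_eqI)
  fix i
  obtain a where a: "a \<in> A" using assms(2) by blast
  have ge: "v \<le> J (x / y j)" if "j \<in> {1..N}" for j
    using assms(3,4)[of j] that by (cases "j \<in> A") auto
  show "i \<in> argmin_index N y x \<longleftrightarrow> i \<in> A"
  proof
    assume "i \<in> argmin_index N y x"
    then have i: "i \<in> {1..N}" and le: "\<not> (J (x / y a) < J (x / y i))"
      using a assms(1) by (auto simp: argmin_index_def is_arg_min_def)
    show "i \<in> A"
      using le assms(3)[OF a] assms(4)[of i] i by auto
  next
    assume "i \<in> A"
    then show "i \<in> argmin_index N y x"
      using assms(1) assms(3)[of i] ge
      by (fastforce simp: argmin_index_def is_arg_min_def not_less)
  qed
qed

context
  fixes N :: nat and y :: "nat \<Rightarrow> real"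
  assumes y_pos: "\<And>i. i \<in> {1..N} \<Longrightarrow> y i > 0"
    and y_mono: "strict_mono_on {1..N} y"
begin

lemma y_less: "1 \<le> i \<Longrightarrow> i < j \<Longrightarrow> j \<le> N \<Longrightarrow> y i < y j"
  using y_mono by (auto simp: strict_mono_on_def)

lemma y_le: "1 \<le> i \<Longrightarrow> i \<le> j \<Longrightarrow> j \<le> N \<Longrightarrow> y i \<le> y j"
  using y_less[of i j] by (cases "i = j") auto

text \<open>Since \<open>y (Suc k)\<close> is the least reference value above \<open>y k\<close>, a
  scale below the geometric mean of these two is also below that of \<open>y k\<close> and any
  larger \<open>y i\<close>. \<open>J_less_below\<close> is the mirror image.\<close>

lemma J_less_above:
  assumes "x > 0" "1 \<le> k" "k < i" "i \<le> N" "x\<^sup>2 < y k * y (Suc k)"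
  shows "J (x / y k) < J (x / y i)"
proof -
  have "y k * y (Suc k) \<le> y k * y i"
    using assms y_pos[of k] y_le[of "Suc k" i] by (intro mult_left_mono) auto
  with assms(5) have "x\<^sup>2 < y k * y i" by (rule less_le_trans)
  then show ?thesis
    using assms y_pos[of k] y_less[of k i] J_divide_less_iff(1)[of x "y k" "y i"] by auto
qed

lemma J_less_below:
  assumes "x > 0" "1 \<le> i" "i < k" "k \<le> N" "y (k - 1) * y k < x\<^sup>2"
  shows "J (x / y k) < J (x / y i)"
proof -
  have "y i * y k \<le> y (k - 1) * y k"
    using assms y_pos[of k] y_le[of i "k - 1"] by (intro mult_right_mono) auto
  then have "y i * y k < x\<^sup>2" using assms(5) by (rule le_less_trans)
  then show ?thesis
    using assms y_pos[of i] y_less[of i k] J_divide_less_iff(2)[of x "y i" "y k"] by auto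
qed

lemma boundary_eq_sqrt: "k \<in> {1..<N} \<Longrightarrow> boundary N y k = ereal (sqrt (y k * y (Suc k)))"
  by (auto simp: boundary_def)

lemma boundary_nonneg: "k \<le> N \<Longrightarrow> 0 \<le> boundary N y k"
  using y_pos[of k] y_pos[of "Suc k"] by (auto simp: boundary_def)

lemma argmin_index_between_boundaries:
  assumes k: "k \<in> {1..N}"
    and lo: "boundary N y (k - 1) < ereal x" and hi: "ereal x < boundary N y k"
  shows "argmin_index N y x = {k}"
proof -
  have "0 \<le> boundary N y (k - 1)" using k by (intro boundary_nonneg) auto
  then have "0 < ereal x" using lo by (rule le_less_trans)
  then have x: "x > 0" by simp
  \<comment> \<open>For \<open>k = N\<close> the upper boundary is infinite, but then no index above
    \<open>k\<close> is left to beat.\<close>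
  have above: "x\<^sup>2 < y k * y (Suc k)" if "k < N"
  proof -
    have "x < sqrt (y k * y (Suc k))"
      using hi k that boundary_eq_sqrt[of k] by simp
    then show ?thesis
      \<comment> \<open>Taking roots on both sides turns the goal into
        \<open>x < sqrt (y k * y (Suc k))\<close>, because \<open>x\<close> is positive.\<close>
      using x by (simp flip: real_sqrt_less_iff[of "x\<^sup>2"])
  qed
  \<comment> \<open>For \<open>k = 1\<close> the lower boundary is 0 and no smaller index competes,
    so \<open>y 0\<close> never enters.\<close>
  have below: "y (k - 1) * y k < x\<^sup>2" if "1 < k"
  proof -
    have "sqrt (y (k - 1) * y k) < x"
      using lo k that by (auto simp: boundary_def split: if_splits)
    then show ?thesis
      using x by (simp flip: real_sqrt_less_iff[of _ "x\<^sup>2"])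
  qed
  show ?thesis
  proof (rule argmin_index_eqI)
    fix i assume i: "i \<in> {1..N} - {k}"
    show "J (x / y k) < J (x / y i)"
    proof (cases "k < i")
      case True
      then show ?thesis using J_less_above[of x k i] x k i above by auto
    next
      case False
      then show ?thesis using J_less_below[of x i k] x k i below by auto
    qed
  qed (use k in auto)
qed

lemma argmin_index_at_boundary:
  assumes k: "k \<in> {1..<N}" and eq: "ereal x = boundary N y k"
  shows "argmin_index N y x = {k, k + 1}"
proof -
  have pos: "y k > 0" "y (Suc k) > 0" using k y_pos by auto
  have x_eq: "x = sqrt (y k * y (Suc k))"
    using eq k boundary_eq_sqrt[of k] by simp
  have x: "x > 0" and sq: "x\<^sup>2 = y k * y (Suc k)"
    using pos by (simp_all add: x_eq)
  \<comment> \<open>The factor \<open>x\<^sup>2 - a * b\<close> of the difference vanishes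
    here.\<close>
  have tie: "J (x / y (Suc k)) = J (x / y k)"
    using J_divide_diff[of x "y k" "y (Suc k)"] x pos sq by simp
  show ?thesis
  proof (rule argmin_index_eqI)
    fix i assume i: "i \<in> {1..N} - {k, k + 1}"
    show "J (x / y k) < J (x / y i)"
    proof (cases "k < i")
      case True
      \<comment> \<open>Now \<open>i\<close> is at least \<open>k + 2\<close>. At the boundary
        \<open>J_less_above\<close> is not strict enough for \<open>k\<close> itself, so it is
        applied to \<open>Suc k\<close> and the result carried over to \<open>k\<close> by
        \<open>tie\<close>.\<close>
      then have "y k < y (Suc (Suc k))" using k i y_less[of k "Suc (Suc k)"] by auto
      then have "x\<^sup>2 < y (Suc k) * y (Suc (Suc k))"
        using pos sq by (simp add: mult.commute)
      then show ?thesis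
        using J_less_above[of x "Suc k" i] x k i True tie by auto
    next
      case False
      \<comment> \<open>Here \<open>i < k\<close> forces \<open>k\<close> to be at least 2, so
        \<open>k - 1\<close> is a genuine index.\<close>
      then have "y (k - 1) < y (Suc k)" using k i y_less[of "k - 1" "Suc k"] by auto
      then have "y (k - 1) * y k < x\<^sup>2"
        using pos sq by (simp add: mult.commute)
      then show ?thesis
        using J_less_below[of x i k] x k i False by auto
    qed
  qed (use k tie in auto)
qed

end

text \<open>Transfers the index computations to objects: the cost of \<open>ob i\<close> is
  \<open>J (x / y i)\<close> with \<open>x\<close> the scale of \<open>s\<close>.\<close>

lemma Mean_ref_cost_eq_argmin_index:
  assumes "Obj = ob ` {1..N}" and "\<And>i. i \<in> {1..N} \<Longrightarrow> y i = \<iota>O (ob i)"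
  shows "Mean (ref_cost \<iota>S \<iota>O) Obj s = ob ` argmin_index N y (\<iota>S s)"
  using assms(2)
  by (auto simp: Mean_def ref_cost_def argmin_index_def is_arg_min_def assms(1) not_less)

theorem theorem7p3:
  fixes S :: "'s set" and Obj :: "'o set"
    and \<iota>S :: "'s \<Rightarrow> real" and \<iota>O :: "'o \<Rightarrow> real"
    and N :: nat and ob :: "nat \<Rightarrow> 'o" and y :: "nat \<Rightarrow> real" and m :: "nat \<Rightarrow> ereal"
  assumes S_pos: "\<And>s. s \<in> S \<Longrightarrow> \<iota>S s > 0"
    and Obj_eq: "Obj = ob ` {1..N}"
    and Obj_pos: "\<And>p. p \<in> Obj \<Longrightarrow> \<iota>O p > 0"
    and y_eq: "\<And>i. i \<in> {1..N} \<Longrightarrow> y i = \<iota>O (ob i)"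
    and y_ordered: "strict_mono_on {1..N} y"
    and m_eq: "m = boundary N y"
  shows
    "(\<forall>s\<in>S. \<forall>k\<in>{1..N}. m (k - 1) < ereal (\<iota>S s) \<and> ereal (\<iota>S s) < m k \<longrightarrow>
        Mean (ref_cost \<iota>S \<iota>O) Obj s = {ob k}) \<and>
     (\<forall>s\<in>S. \<forall>k\<in>{1..<N}. ereal (\<iota>S s) = m k \<longrightarrow>
        Mean (ref_cost \<iota>S \<iota>O) Obj s = {ob k, ob (k + 1)} \<and>
        card (Mean (ref_cost \<iota>S \<iota>O) Obj s) = 2) \<and>
     (\<forall>k\<in>{1..N}.
        argmin_index N y constant_on {x. m (k - 1) < ereal x \<and> ereal x < m k} \<and>
        (\<forall>x. m (k - 1) < ereal x \<and> ereal x < m k \<longrightarrow> argmin_index N y x = {k})) \<and>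
     (\<forall>k\<in>{1..<N}. \<forall>x. ereal x = m k \<longrightarrow> argmin_index N y x = {k, k + 1})"
proof -
  have y_pos: "y i > 0" if "i \<in> {1..N}" for i
    using that y_eq Obj_pos Obj_eq by auto
  note between = argmin_index_between_boundaries[OF y_pos y_ordered, folded m_eq]
  note at = argmin_index_at_boundary[OF y_pos y_ordered, folded m_eq]
  have Mean_eq: "Mean (ref_cost \<iota>S \<iota>O) Obj s = ob ` argmin_index N y (\<iota>S s)" for s
    using Obj_eq y_eq by (rule Mean_ref_cost_eq_argmin_index)
  \<comment> \<open>Distinct scales separate the two tied objects, which gives cardinality
    2.\<close>
  have ob_neq: "ob k \<noteq> ob (k + 1)" if "k \<in> {1..<N}" for k
  proof -
    have "y k < y (k + 1)" using that y_less[OF y_pos y_ordered, of k "k + 1"] by auto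
    then show ?thesis using that y_eq[of k] y_eq[of "k + 1"] by auto
  qed
  show ?thesis
  proof (intro conjI ballI allI impI)
    fix k assume "k \<in> {1..N}"
    then show "argmin_index N y constant_on {x. m (k - 1) < ereal x \<and> ereal x < m k}"
      using between by (auto simp: constant_on_def)
  qed (use between at ob_neq in \<open>auto simp: Mean_eq\<close>)
qed

end
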